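(* Let $f\in\mathcal A$, $L'u=f^2Lu$, $N\in[1,\infty)$ and $k:X\to\mathbb R$. Assume that $L$ satisfies the $\mathrm{BE}(k,N)$-condition. Then for every $N'\in(N,\infty]$ the operator $L'$ satisfies the $\mathrm{BE}(k',N')$-condition with $$k'=f^2k+\frac12Lf^2-N^*\,\Gamma(f),\qquad N^*=2+\frac{[(N-2)(N'-2)]_+}{N'-N}\ \ge\ \max\{N,2\}.$$ In particular, $L'$ satisfies the $\mathrm{BE}(k'_\infty,\infty)$-condition with $$k'_\infty=f^2k+\frac12Lf^2-\max\{N,2\}\,\Gamma(f).$$
   Context: Let $X$ be a set, $\mathcal A$ an algebra of real-valued functions on $X$ and $L:\mathcal A\to\mathcal A$ a linear operator. Put $\Gamma(f,g)=\frac12[L(fg)-fLg-gLf]$ and $\Gamma(f)=\Gamma(f,f)$. $L$ is assumed to be a diffusion operator: $\Gamma(f)\ge0$ for all $f\in\mathcal A$, and for all $r$, all $f_1,\dots,f_r\in\mathcal A$ and every $C^\infty$ function $\psi:\mathbb R^r\to\mathbb R$ with $\psi(0)=0$ one has $\psi(f_1,\dots,f_r)\in\mathcal A$ and $L\psi(f_1,\dots,f_r)=\sum_i\psi_i(f_1,\dots,f_r)\,Lf_i+\sum_{i,j}\psi_{ij}(f_1,\dots,f_r)\,\Gamma(f_i,f_j)$, where $\psi_i,\psi_{ij}$ are partial derivatives. Define $\Gamma_2(f,g)=\frac12[L\Gamma(f,g)-\Gamma(f,Lg)-\Gamma(g,Lf)]$, $\Gamma_2(f)=\Gamma_2(f,f)$.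 Bakry–Émery condition: $L$ satisfies $\mathrm{BE}(k,N)$, $N\in[1,\infty]$ (with $1/\infty=0$), if $\Gamma_2(u)(x)\ge k(x)\,\Gamma(u)(x)+\frac1N(Lu)^2(x)$ for all $u\in\mathcal A$, $x\in X$. For $L'$ the condition is formed with $\Gamma',\Gamma_2'$, defined by the same formulas with $L'$ in place of $L$. $[a]_+=\max\{a,0\}$. For $N'=\infty$ the quotient defining $N^*$ is read as its limit $[N-2]_+$. *)

theory Defs
  imports "HOL-Analysis.Analysis"
begin

section \<open>Smooth functions of finitely many real variables\<close>

text \<open>
  The number \<open>r\<close> of variables is quantified inside the definition of a diffusion operator and
  hence cannot be a type. A function on \<open>\<real>\<^sup>r\<close> is represented by a function on \<open>nat \<Rightarrow> real\<close> that
  depends only on the coordinates \<open>0, \<dots>, r - 1\<close>. For such functions, continuity in the product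
  topology of \<open>nat \<Rightarrow> real\<close> is the same as continuity on \<open>\<real>\<^sup>r\<close>.
\<close>

definition depends_on_first :: "nat \<Rightarrow> ((nat \<Rightarrow> real) \<Rightarrow> real) \<Rightarrow> bool" where
  "depends_on_first r \<psi> \<longleftrightarrow> (\<forall>y z. (\<forall>i<r. y i = z i) \<longrightarrow> \<psi> y = \<psi> z)"

definition partial_deriv :: "nat \<Rightarrow> ((nat \<Rightarrow> real) \<Rightarrow> real) \<Rightarrow> (nat \<Rightarrow> real) \<Rightarrow> real" where
  "partial_deriv i \<psi> y = deriv (\<lambda>t. \<psi> (y(i := t))) (y i)"

definition has_partial_deriv :: "nat \<Rightarrow> ((nat \<Rightarrow> real) \<Rightarrow> real) \<Rightarrow> bool" where
  "has_partial_deriv i \<psi> \<longleftrightarrow> (\<forall>y. (\<lambda>t. \<psi> (y(i := t))) field_differentiable (at (y i)))"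

definition iterated_partial_deriv ::
  "nat list \<Rightarrow> ((nat \<Rightarrow> real) \<Rightarrow> real) \<Rightarrow> (nat \<Rightarrow> real) \<Rightarrow> real" where
  "iterated_partial_deriv is \<psi> = foldr partial_deriv is \<psi>"

definition smooth_function :: "nat \<Rightarrow> ((nat \<Rightarrow> real) \<Rightarrow> real) \<Rightarrow> bool" where
  "smooth_function r \<psi> \<longleftrightarrow>
     depends_on_first r \<psi> \<and>
     (\<forall>is. set is \<subseteq> {..<r} \<longrightarrow>
        continuous_on UNIV (iterated_partial_deriv is \<psi>) \<and>
        (\<forall>i<r. has_partial_deriv i (iterated_partial_deriv is \<psi>)))"


section \<open>Diffusion operators\<close>

locale function_algebra =
  fixes A :: "('x \<Rightarrow> real) set"
  assumes zero_mem: "(\<lambda>x. 0) \<in> A"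
    and add_mem: "f \<in> A \<Longrightarrow> g \<in> A \<Longrightarrow> (\<lambda>x. f x + g x) \<in> A"
    and scale_mem: "f \<in> A \<Longrightarrow> (\<lambda>x. c * f x) \<in> A"
    and mult_mem: "f \<in> A \<Longrightarrow> g \<in> A \<Longrightarrow> (\<lambda>x. f x * g x) \<in> A"

definition carre_du_champ ::
  "(('x \<Rightarrow> real) \<Rightarrow> 'x \<Rightarrow> real) \<Rightarrow> ('x \<Rightarrow> real) \<Rightarrow> ('x \<Rightarrow> real) \<Rightarrow> 'x \<Rightarrow> real" where
  "carre_du_champ L f g = (\<lambda>x. 1/2 * (L (\<lambda>y. f y * g y) x - f x * L g x - g x * L f x))"

definition Gamma2 ::
  "(('x \<Rightarrow> real) \<Rightarrow> 'x \<Rightarrow> real) \<Rightarrow> ('x \<Rightarrow> real) \<Rightarrow> ('x \<Rightarrow> real) \<Rightarrow> 'x \<Rightarrow> real" where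
  "Gamma2 L f g =
     (\<lambda>x. 1/2 * (L (carre_du_champ L f g) x - carre_du_champ L f (L g) x - carre_du_champ L g (L f) x))"

text \<open>
  An operator on the algebra \<open>A\<close> is given by a function on all of \<open>'x \<Rightarrow> real\<close>, of which only the
  values on \<open>A\<close> matter.
\<close>

locale diffusion_operator = function_algebra A
  for A :: "('x \<Rightarrow> real) set" +
  fixes L :: "('x \<Rightarrow> real) \<Rightarrow> 'x \<Rightarrow> real"
  assumes L_mem: "f \<in> A \<Longrightarrow> L f \<in> A"
    and L_add: "f \<in> A \<Longrightarrow> g \<in> A \<Longrightarrow> L (\<lambda>x. f x + g x) = (\<lambda>x. L f x + L g x)"
    and L_scale: "f \<in> A \<Longrightarrow> L (\<lambda>x. c * f x) = (\<lambda>x. c * L f x)"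
    and carre_du_champ_nonneg: "f \<in> A \<Longrightarrow> carre_du_champ L f f x \<ge> 0"
    and smooth_mem:
      "(\<And>i. i < r \<Longrightarrow> F i \<in> A) \<Longrightarrow> smooth_function r \<psi> \<Longrightarrow> \<psi> (\<lambda>i. 0) = 0 \<Longrightarrow>
         (\<lambda>x. \<psi> (\<lambda>i. F i x)) \<in> A"
    and L_smooth:
      "(\<And>i. i < r \<Longrightarrow> F i \<in> A) \<Longrightarrow> smooth_function r \<psi> \<Longrightarrow> \<psi> (\<lambda>i. 0) = 0 \<Longrightarrow>
         L (\<lambda>x. \<psi> (\<lambda>i. F i x)) x =
           (\<Sum>i<r. partial_deriv i \<psi> (\<lambda>i. F i x) * L (F i) x) +
           (\<Sum>i<r. \<Sum>j<r.
              partial_deriv j (partial_deriv i \<psi>) (\<lambda>i. F i x) * carre_du_champ L (F i) (F j) x)"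


section \<open>The Bakry--Emery condition\<close>

text \<open>In \<^typ>\<open>ereal\<close> the quotient \<open>1 / \<infinity>\<close> is \<open>0\<close>. Dimension parameters are understood to lie in
  \<open>[1, \<infinity>]\<close>.\<close>

definition bakry_emery ::
  "('x \<Rightarrow> real) set \<Rightarrow> (('x \<Rightarrow> real) \<Rightarrow> 'x \<Rightarrow> real) \<Rightarrow> ('x \<Rightarrow> real) \<Rightarrow> ereal \<Rightarrow> bool" where
  "bakry_emery A L k N \<longleftrightarrow>
     (\<forall>u\<in>A. \<forall>x. Gamma2 L u u x \<ge> k x * carre_du_champ L u u x + real_of_ereal (1 / N) * (L u x)\<^sup>2)"

definition time_change ::
  "('x \<Rightarrow> real) \<Rightarrow> (('x \<Rightarrow> real) \<Rightarrow> 'x \<Rightarrow> real) \<Rightarrow> ('x \<Rightarrow> real) \<Rightarrow> 'x \<Rightarrow> real" where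
  "time_change f L u = (\<lambda>x. (f x)\<^sup>2 * L u x)"

text \<open>At \<open>N' = \<infinity>\<close> the quotient is replaced by its limit.\<close>

definition N_star :: "real \<Rightarrow> ereal \<Rightarrow> real" where
  "N_star N N' =
     (if N' = \<infinity> then 2 + max (N - 2) 0
      else 2 + max ((N - 2) * (real_of_ereal N' - 2)) 0 / (real_of_ereal N' - N))"

end

theory Submission
  imports Defs
begin

text \<open>
  Write \<open>\<Gamma>\<close> for the carre du champ of \<open>L\<close>. Everything happens at one point \<open>x\<close>. The Leibniz rules
  for \<open>L\<close> and \<open>\<Gamma>\<close> give, for \<open>L' = f\<^sup>2 L\<close>,
  \<open>\<Gamma>\<^sub>2'(u) = f\<^sup>2 (f\<^sup>2 \<Gamma>\<^sub>2(u) + 1/2 L(f\<^sup>2) \<Gamma>(u) + 2 f \<Gamma>(f, \<Gamma>(u)) - 2 f Lu \<Gamma>(u, f))\<close>,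
  so that a lower bound for \<open>f\<^sup>2 \<Gamma>\<^sub>2(u) + 2 f \<Gamma>(f, \<Gamma>(u))\<close> is required. The term \<open>2 f \<Gamma>(f, \<Gamma>(u))\<close> is
  four times \<open>f\<close> times the Hessian of \<open>u\<close> in the directions \<open>u\<close> and \<open>f\<close>, and the condition
  \<open>BE(k, N)\<close>, although it speaks of \<open>\<Gamma>\<^sub>2\<close> only, controls it by Bakry's self-improvement: apply
  \<open>BE(k, N)\<close> at \<open>x\<close> to a test function that has the gradient of \<open>f(x) u\<close> at \<open>x\<close> but another
  second-order part. The right choice is \<open>v = (u - u(x)) f\<close>, for which at \<open>x\<close>
  \<open>Lv = f Lu + 2 \<Gamma>(u, f)\<close>, \<open>\<Gamma>(v) = f\<^sup>2 \<Gamma>(u)\<close> and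
  \<open>\<Gamma>\<^sub>2(v) = f\<^sup>2 \<Gamma>\<^sub>2(u) + 2 f \<Gamma>(f, \<Gamma>(u)) + 2 \<Gamma>(u) \<Gamma>(f) + 2 \<Gamma>(u, f)\<^sup>2\<close>
  (lemma \<open>Gamma2_vanishing_product\<close>).

  After this substitution, and after \<open>\<Gamma>(u, f)\<^sup>2 \<le> \<Gamma>(u) \<Gamma>(f)\<close>, the claim is that a quadratic form in
  the two numbers \<open>a = f Lu\<close> and \<open>b = \<Gamma>(u, f)\<close> is nonnegative, namely
  \<open>(1/N - 1/N') a\<^sup>2 + 2 (2/N - 1) a b + (4/N + N\<^sup>* - 4) b\<^sup>2\<close>.
  The constant \<open>N\<^sup>*\<close> is the least number, not below \<open>2\<close>, for which the discriminant has the right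
  sign (lemma \<open>N_star_discriminant\<close>).
\<close>

section \<open>Multilinear monomials are smooth\<close>

lemma has_field_derivative_multilinear_monomial:
  fixes c :: real
  assumes "finite S"
  shows "((\<lambda>t. c * (\<Prod>j\<in>S. (y(i := t)) j)) has_field_derivative
           (if i \<in> S then c * (\<Prod>j\<in>S - {i}. y j) else 0)) (at (y i))"
proof (cases "i \<in> S")
  case True
  have "(\<Prod>j\<in>S. (y(i := t)) j) = t * (\<Prod>j\<in>S - {i}. y j)" for t
    using assms True by (subst prod.remove[of S i]) (auto intro!: prod.cong)
  then show ?thesis
    using True by (auto intro!: derivative_eq_intros)
next
  case False
  then have "(\<Prod>j\<in>S. (y(i := t)) j) = (\<Prod>j\<in>S. y j)" for t
    by (intro prod.cong) auto
  then show ?thesis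
    using False by simp
qed

lemma partial_deriv_multilinear_monomial:
  assumes "finite S"
  shows "partial_deriv i (\<lambda>y. c * (\<Prod>j\<in>S. y j)) =
           (if i \<in> S then (\<lambda>y. c * (\<Prod>j\<in>S - {i}. y j)) else (\<lambda>y. 0))"
  unfolding partial_deriv_def
  using DERIV_imp_deriv[OF has_field_derivative_multilinear_monomial[OF assms]] by auto

text \<open>The coefficient \<open>c\<close> makes the family of monomials closed under partial derivatives: the
  derivative in a missing variable is the monomial with coefficient \<open>0\<close>.\<close>

lemma iterated_partial_deriv_multilinear_monomial:
  assumes "finite S"
  shows "\<exists>c' T. finite T \<and> iterated_partial_deriv is (\<lambda>y. c * (\<Prod>j\<in>S. y j)) = (\<lambda>y. c' * (\<Prod>j\<in>T. y j))"
proof (induction "is")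
  case Nil
  show ?case using assms by (auto simp: iterated_partial_deriv_def)
next
  case (Cons i "is")
  then obtain c' T where T: "finite T"
    and eq: "iterated_partial_deriv is (\<lambda>y. c * (\<Prod>j\<in>S. y j)) = (\<lambda>y. c' * (\<Prod>j\<in>T. y j))"
    by blast
  have step: "iterated_partial_deriv (i # is) (\<lambda>y. c * (\<Prod>j\<in>S. y j)) =
      partial_deriv i (\<lambda>y. c' * (\<Prod>j\<in>T. y j))"
    using eq by (simp add: iterated_partial_deriv_def)
  show ?case
  proof (cases "i \<in> T")
    case True
    then show ?thesis
      using T by (intro exI[of _ c'] exI[of _ "T - {i}"])
        (simp add: step partial_deriv_multilinear_monomial)
  next
    case False
    then show ?thesis
      using T by (intro exI[of _ 0] exI[of _ T])
        (simp add: step partial_deriv_multilinear_monomial)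
  qed
qed

lemma smooth_function_multilinear_monomial:
  assumes "S \<subseteq> {..<r}"
  shows "smooth_function r (\<lambda>y. c * (\<Prod>j\<in>S. y j))"
proof -
  have fin: "finite S"
    using assms finite_subset by blast
  have "depends_on_first r (\<lambda>y. c * (\<Prod>j\<in>S. y j))"
    unfolding depends_on_first_def using assms by (auto intro!: prod.cong)
  moreover have "continuous_on UNIV (iterated_partial_deriv is (\<lambda>y. c * (\<Prod>j\<in>S. y j))) \<and>
      has_partial_deriv i (iterated_partial_deriv is (\<lambda>y. c * (\<Prod>j\<in>S. y j)))" for "is" i
  proof -
    obtain c' T where T: "finite T"
      and eq: "iterated_partial_deriv is (\<lambda>y. c * (\<Prod>j\<in>S. y j)) = (\<lambda>y. c' * (\<Prod>j\<in>T. y j))"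
      using iterated_partial_deriv_multilinear_monomial[OF fin] by blast
    have "continuous_on UNIV (\<lambda>y::nat \<Rightarrow> real. c' * (\<Prod>j\<in>T. y j))"
      by (intro continuous_intros continuous_on_coordinatewise_then_product) auto
    then show ?thesis
      using has_field_derivative_multilinear_monomial[OF T]
      unfolding eq has_partial_deriv_def field_differentiable_def by blast
  qed
  ultimately show ?thesis
    unfolding smooth_function_def by blast
qed

section \<open>Calculus of the carre du champ\<close>

context diffusion_operator
begin

abbreviation \<Gamma> where "\<Gamma> \<equiv> carre_du_champ L"

lemma diff_mem: "u \<in> A \<Longrightarrow> v \<in> A \<Longrightarrow> (\<lambda>x. u x - v x) \<in> A"
  using add_mem[of u "\<lambda>x. -1 * v x"] scale_mem[of v "-1"] by simp

lemma L_diff: "u \<in> A \<Longrightarrow> v \<in> A \<Longrightarrow> L (\<lambda>x. u x - v x) = (\<lambda>x. L u x - L v x)"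
  using L_add[of u "\<lambda>x. -1 * v x"] scale_mem[of v "-1"] L_scale[of v "-1"] by simp

lemma carre_du_champ_mem: "u \<in> A \<Longrightarrow> v \<in> A \<Longrightarrow> \<Gamma> u v \<in> A"
  unfolding carre_du_champ_def by (intro scale_mem diff_mem L_mem mult_mem)

lemma carre_du_champ_commute: "\<Gamma> u v = \<Gamma> v u"
  unfolding carre_du_champ_def by (simp add: mult.commute algebra_simps)

lemma L_mult: "L (\<lambda>x. u x * v x) x = u x * L v x + v x * L u x + 2 * \<Gamma> u v x"
  unfolding carre_du_champ_def by (simp add: field_simps)

lemma carre_du_champ_add_left:
  assumes "u \<in> A" "v \<in> A" "w \<in> A"
  shows "\<Gamma> (\<lambda>x. u x + v x) w x = \<Gamma> u w x + \<Gamma> v w x"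
proof -
  have "L (\<lambda>y. (u y + v y) * w y) = (\<lambda>x. L (\<lambda>y. u y * w y) x + L (\<lambda>y. v y * w y) x)"
    using L_add[OF mult_mem[OF assms(1,3)] mult_mem[OF assms(2,3)]] by (simp add: distrib_right)
  then show ?thesis
    unfolding carre_du_champ_def using assms by (simp add: L_add algebra_simps)
qed

lemma carre_du_champ_scale_left:
  assumes "u \<in> A" "w \<in> A"
  shows "\<Gamma> (\<lambda>x. c * u x) w x = c * \<Gamma> u w x"
proof -
  have "L (\<lambda>y. c * u y * w y) = (\<lambda>x. c * L (\<lambda>y. u y * w y) x)"
    using L_scale[OF mult_mem[OF assms], of c] by (simp add: mult.assoc)
  then show ?thesis
    unfolding carre_du_champ_def using assms by (simp add: L_scale algebra_simps)
qed

lemma carre_du_champ_diff_left: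
  assumes "u \<in> A" "v \<in> A" "w \<in> A"
  shows "\<Gamma> (\<lambda>x. u x - v x) w x = \<Gamma> u w x - \<Gamma> v w x"
  using carre_du_champ_add_left[OF assms(1) scale_mem[OF assms(2), of "-1"] assms(3)]
    carre_du_champ_scale_left[OF assms(2,3), of "-1"] by simp

text \<open>The chain rule for the monomial \<open>y\<^sub>0 y\<^sub>1 y\<^sub>2\<close> is what makes \<open>\<Gamma>\<close> a derivation: compared with
  \<open>L((u v) w)\<close> expanded by the definition of \<open>\<Gamma>\<close>, it leaves the Leibniz rule for \<open>\<Gamma>(u v, w)\<close>.\<close>

lemma L_triple_product:
  assumes "u \<in> A" "v \<in> A" "w \<in> A"
  shows "L (\<lambda>x. u x * v x * w x) x =
    u x * v x * L w x + u x * w x * L v x + v x * w x * L u x +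
    2 * (u x * \<Gamma> v w x + v x * \<Gamma> u w x + w x * \<Gamma> u v x)"
proof -
  define F where "F = (\<lambda>i::nat. if i = 0 then u else if i = 1 then v else w)"
  have F: "F i \<in> A" for i
    using assms by (simp add: F_def)
  define M where "M S = (\<lambda>y::nat \<Rightarrow> real. \<Prod>j\<in>S. y j)" for S
  have smooth: "smooth_function 3 (M {..<3})"
    using smooth_function_multilinear_monomial[of "{..<3}" 3 1] by (simp add: M_def)
  have pd: "partial_deriv i (M S) = (if i \<in> S then M (S - {i}) else (\<lambda>y. 0))" if "finite S" for i S
    using partial_deriv_multilinear_monomial[OF that, of i 1] by (simp add: M_def)
  have three: "{..<3} = {0, Suc 0, Suc (Suc 0)}"
    by auto
  have "L (\<lambda>x. M {..<3} (\<lambda>i. F i x)) x =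
      (\<Sum>i<3. partial_deriv i (M {..<3}) (\<lambda>i. F i x) * L (F i) x) +
      (\<Sum>i<3. \<Sum>j<3. partial_deriv j (partial_deriv i (M {..<3})) (\<lambda>i. F i x) * \<Gamma> (F i) (F j) x)"
    by (rule L_smooth[OF F smooth]) (simp add: M_def three)
  then have "L (\<lambda>x. M {0, Suc 0, Suc (Suc 0)} (\<lambda>i. F i x)) x =
      u x * v x * L w x + u x * w x * L v x + v x * w x * L u x +
      2 * (u x * \<Gamma> v w x + v x * \<Gamma> u w x + w x * \<Gamma> u v x)"
    using carre_du_champ_commute[of v u] carre_du_champ_commute[of w u]
      carre_du_champ_commute[of w v]
    by (simp add: three pd insert_Diff_if) (simp add: M_def F_def algebra_simps)
  moreover have "(\<lambda>x. M {0, Suc 0, Suc (Suc 0)} (\<lambda>i. F i x)) = (\<lambda>x. u x * v x * w x)"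
    by (simp add: M_def F_def mult.assoc)
  ultimately show ?thesis
    by simp
qed

lemma carre_du_champ_mult_left:
  assumes "u \<in> A" "v \<in> A" "w \<in> A"
  shows "\<Gamma> (\<lambda>x. u x * v x) w x = u x * \<Gamma> v w x + v x * \<Gamma> u w x"
  using L_triple_product[OF assms, of x] L_mult[of u v x] L_mult[of "\<lambda>x. u x * v x" w x]
  by (simp add: algebra_simps)

lemma carre_du_champ_Cauchy_Schwarz:
  assumes "u \<in> A" "v \<in> A"
  shows "(\<Gamma> u v x)\<^sup>2 \<le> \<Gamma> u u x * \<Gamma> v v x"
proof -
  have poly: "0 \<le> \<Gamma> u u x + 2 * t * \<Gamma> u v x + t\<^sup>2 * \<Gamma> v v x" for t
  proof -
    have m: "(\<lambda>x. t * v x) \<in> A" using assms scale_mem by blast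
    let ?w = "\<lambda>x. u x + t * v x"
    have w: "?w \<in> A" using add_mem[OF assms(1) m] .
    have left: "\<Gamma> ?w z x = \<Gamma> u z x + t * \<Gamma> v z x" if "z \<in> A" for z
      using carre_du_champ_add_left[OF assms(1) m that] carre_du_champ_scale_left[OF assms(2) that]
      by simp
    have "\<Gamma> ?w ?w x = \<Gamma> ?w u x + t * \<Gamma> ?w v x"
      using left[OF w] carre_du_champ_commute[of ?w u] carre_du_champ_commute[of ?w v] by simp
    also have "\<dots> = \<Gamma> u u x + 2 * t * \<Gamma> u v x + t\<^sup>2 * \<Gamma> v v x"
      using left[OF assms(1)] left[OF assms(2)] carre_du_champ_commute[of v u]
      by (simp add: algebra_simps power2_eq_square)
    finally show ?thesis
      using carre_du_champ_nonneg[OF w, of x] by simp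
  qed
  show ?thesis
  proof (cases "\<Gamma> v v x = 0")
    case True
    have "\<Gamma> u v x = 0"
    proof (rule ccontr)
      assume ne: "\<Gamma> u v x \<noteq> 0"
      \<comment> \<open>a nonconstant affine function of \<open>t\<close> takes the value \<open>-1\<close>\<close>
      show False
        using poly[of "- (\<Gamma> u u x + 1) / (2 * \<Gamma> u v x)"] ne True by (simp add: field_simps)
    qed
    then show ?thesis using True by simp
  next
    case False
    then have pos: "\<Gamma> v v x > 0"
      using carre_du_champ_nonneg[OF assms(2), of x] by simp
    have "0 \<le> \<Gamma> u u x - (\<Gamma> u v x)\<^sup>2 / \<Gamma> v v x"
      using poly[of "- \<Gamma> u v x / \<Gamma> v v x"] pos by (simp add: field_simps power2_eq_square)
    then show ?thesis
      using pos by (simp add: field_simps)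
  qed
qed

section \<open>The test function and the operator after the time change\<close>

text \<open>\<open>(u - u(x)) h\<close> is expanded, because the constant \<open>u(x)\<close> need not lie in \<open>A\<close>.\<close>

lemma vanishing_product_mem:
  "u \<in> A \<Longrightarrow> h \<in> A \<Longrightarrow> (\<lambda>y. u y * h y - c * h y) \<in> A"
  by (intro diff_mem mult_mem scale_mem)

lemma L_vanishing_product:
  assumes "u \<in> A" "h \<in> A"
  shows "L (\<lambda>y. u y * h y - u x * h y) x = h x * L u x + 2 * \<Gamma> u h x"
  using assms by (simp add: L_diff mult_mem scale_mem L_scale L_mult)

lemma carre_du_champ_vanishing_product:
  assumes "u \<in> A" "h \<in> A" "w \<in> A"
  shows "\<Gamma> (\<lambda>y. u y * h y - c * h y) w y = (u y - c) * \<Gamma> h w y + h y * \<Gamma> u w y"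
  using assms by (simp add: carre_du_champ_diff_left mult_mem scale_mem
      carre_du_champ_mult_left carre_du_champ_scale_left algebra_simps)

text \<open>The gain over \<open>f\<^sup>2 \<Gamma>\<^sub>2(u)\<close> comes from the Hessian of \<open>(u - u(x)) f\<close> at \<open>x\<close>, which exceeds that of
  \<open>f(x) u\<close> by the sum of the two tensor products of the gradients of \<open>u\<close> and \<open>f\<close>: the mixed term
  is \<open>2 f \<Gamma>(f, \<Gamma>(u))\<close> and the squared norm of this sum is \<open>2 \<Gamma>(u) \<Gamma>(f) + 2 \<Gamma>(u, f)\<^sup>2\<close>.\<close>

lemma Gamma2_vanishing_product:
  fixes x
  assumes u: "u \<in> A" and f: "f \<in> A"
  defines "v \<equiv> \<lambda>y. u y * f y - u x * f y"
  shows "Gamma2 L v v x = (f x)\<^sup>2 * Gamma2 L u u x + 2 * f x * \<Gamma> f (\<Gamma> u u) x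
           + 2 * \<Gamma> u u x * \<Gamma> f f x + 2 * (\<Gamma> u f x)\<^sup>2"
proof -
  have v: "v \<in> A"
    unfolding v_def using u f by (rule vanishing_product_mem)
  note mem = u f v L_mem mult_mem scale_mem add_mem diff_mem carre_du_champ_mem
  define c where "c = u x"
  have v_c: "v = (\<lambda>y. u y * f y - c * f y)"
    by (simp add: v_def c_def)
  have \<Gamma>v: "\<Gamma> v w y = (u y - c) * \<Gamma> f w y + f y * \<Gamma> u w y" if "w \<in> A" for w y
    unfolding v_c by (rule carre_du_champ_vanishing_product[OF u f that])
  have Lv: "L v = (\<lambda>y. u y * L f y - c * L f y + f y * L u y + 2 * \<Gamma> u f y)"
    unfolding v_c using mem by (simp add: L_diff L_scale L_mult fun_eq_iff)
  have \<Gamma>vLv: "\<Gamma> v (L v) x = f x * (\<Gamma> u u x * L f x + f x * \<Gamma> u (L u) x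
      + L u x * \<Gamma> u f x + 2 * \<Gamma> u (\<Gamma> u f) x)"
  proof -
    have "\<Gamma> (L v) u x = L f x * \<Gamma> u u x + (f x * \<Gamma> (L u) u x + L u x * \<Gamma> f u x)
        + 2 * \<Gamma> (\<Gamma> u f) u x"
      unfolding Lv using mem
      by (simp add: carre_du_champ_add_left carre_du_champ_scale_left carre_du_champ_mult_left
          carre_du_champ_vanishing_product) (simp add: c_def)
    then show ?thesis
      using \<Gamma>v[OF L_mem[OF v], of x] carre_du_champ_commute[of u "L v"]
        carre_du_champ_commute[of f "L v"] carre_du_champ_commute[of u "L u"]
        carre_du_champ_commute[of u "\<Gamma> u f"] carre_du_champ_commute[of f u]
      by (simp add: c_def algebra_simps)
  qed
  \<comment> \<open>\<open>\<Gamma>(v) = (u - c) h + f\<^sup>2 \<Gamma>(u)\<close>, so that \<open>L\<close> of the first summand is again of the special form\<close>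
  define h where "h = (\<lambda>y. (u y * \<Gamma> f f y - c * \<Gamma> f f y) + 2 * (f y * \<Gamma> u f y))"
  have h: "h \<in> A"
    unfolding h_def using mem by simp
  have \<Gamma>vv: "\<Gamma> v v = (\<lambda>y. (u y * h y - c * h y) + (f y * f y) * \<Gamma> u u y)"
  proof
    fix y
    have "\<Gamma> v v y = (u y - c) * \<Gamma> v f y + f y * \<Gamma> v u y"
      using \<Gamma>v[OF v] carre_du_champ_commute[of v f] carre_du_champ_commute[of v u] by simp
    then show "\<Gamma> v v y = (u y * h y - c * h y) + (f y * f y) * \<Gamma> u u y"
      using \<Gamma>v[OF u, of y] \<Gamma>v[OF f, of y] carre_du_champ_commute[of f u]
      by (simp add: h_def algebra_simps)
  qed
  have \<Gamma>uh: "\<Gamma> u h x = \<Gamma> f f x * \<Gamma> u u x + 2 * (f x * \<Gamma> u (\<Gamma> u f) x + (\<Gamma> u f x)\<^sup>2)"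
  proof -
    have "\<Gamma> h u x = \<Gamma> f f x * \<Gamma> u u x + 2 * (f x * \<Gamma> (\<Gamma> u f) u x + \<Gamma> u f x * \<Gamma> f u x)"
      unfolding h_def using mem
      by (simp add: carre_du_champ_add_left carre_du_champ_scale_left carre_du_champ_mult_left
          carre_du_champ_vanishing_product) (simp add: c_def)
    then show ?thesis
      using carre_du_champ_commute[of u h] carre_du_champ_commute[of u "\<Gamma> u f"]
        carre_du_champ_commute[of f u] by (simp add: power2_eq_square)
  qed
  have "L (\<lambda>y. (f y * f y) * \<Gamma> u u y) x = f x * f x * L (\<Gamma> u u) x
      + \<Gamma> u u x * (2 * f x * L f x + 2 * \<Gamma> f f x) + 4 * f x * \<Gamma> f (\<Gamma> u u) x"
    using L_mult[of "\<lambda>y. f y * f y" "\<Gamma> u u" x] L_mult[of f f x]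
      carre_du_champ_mult_left[OF f f carre_du_champ_mem[OF u u], of x]
    by (simp add: algebra_simps)
  then have "L (\<Gamma> v v) x = (h x * L u x + 2 * \<Gamma> u h x) + (f x * f x * L (\<Gamma> u u) x
      + \<Gamma> u u x * (2 * f x * L f x + 2 * \<Gamma> f f x) + 4 * f x * \<Gamma> f (\<Gamma> u u) x)"
    unfolding \<Gamma>vv using mem h L_vanishing_product[OF u h, of x]
    by (simp add: L_add c_def)
  moreover have "h x = 2 * (f x * \<Gamma> u f x)"
    by (simp add: h_def c_def)
  ultimately show ?thesis
    unfolding Gamma2_def using \<Gamma>vLv \<Gamma>uh by (simp add: algebra_simps power2_eq_square)
qed

lemma carre_du_champ_time_change:
  "carre_du_champ (time_change f L) u v = (\<lambda>x. (f x)\<^sup>2 * \<Gamma> u v x)"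
  unfolding carre_du_champ_def time_change_def by (simp add: algebra_simps)

lemma Gamma2_time_change:
  assumes u: "u \<in> A" and f: "f \<in> A"
  shows "Gamma2 (time_change f L) u u x =
    (f x)\<^sup>2 * ((f x)\<^sup>2 * Gamma2 L u u x + 1/2 * L (\<lambda>y. (f y)\<^sup>2) x * \<Gamma> u u x
      + 2 * f x * \<Gamma> f (\<Gamma> u u) x - 2 * f x * L u x * \<Gamma> u f x)"
proof -
  have g: "(\<lambda>y. (f y)\<^sup>2) \<in> A"
    using mult_mem[OF f f] by (simp add: power2_eq_square)
  note mem = u f g L_mem carre_du_champ_mem
  have \<Gamma>g: "\<Gamma> (\<lambda>y. (f y)\<^sup>2) w x = 2 * f x * \<Gamma> f w x" if "w \<in> A" for w
    using carre_du_champ_mult_left[OF f f that] by (simp add: power2_eq_square)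
  have "\<Gamma> u (\<lambda>y. (f y)\<^sup>2 * L u y) x = (f x)\<^sup>2 * \<Gamma> u (L u) x + L u x * (2 * f x * \<Gamma> u f x)"
    using mem \<Gamma>g[OF u] carre_du_champ_mult_left[OF g L_mem[OF u] u, of x]
      carre_du_champ_commute[of u "L u"] carre_du_champ_commute[of u "\<lambda>y. (f y)\<^sup>2 * L u y"]
      carre_du_champ_commute[of f u] by simp
  then show ?thesis
    using \<Gamma>g[OF carre_du_champ_mem[OF u u]] L_mult[of "\<lambda>y. (f y)\<^sup>2" "\<Gamma> u u" x]
    unfolding Gamma2_def carre_du_champ_time_change
    by (simp add: time_change_def algebra_simps)
qed

end

section \<open>The optimal constant\<close>

lemma N_star_ge:
  assumes "ereal N < N'"
  shows "max N 2 \<le> N_star N N'"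
proof (cases N')
  case (real n)
  then have "N < n" using assms by simp
  have "N - 2 \<le> max ((N - 2) * (n - 2)) 0 / (n - N)"
  proof (cases "N \<ge> 2")
    case True
    then have "(N - 2) * (n - N) \<le> (N - 2) * (n - 2)"
      by (intro mult_left_mono) auto
    then show ?thesis
      using \<open>N < n\<close> by (simp add: pos_le_divide_eq)
  next
    case False
    then have "N - 2 \<le> 0" by simp
    also have "0 \<le> max ((N - 2) * (n - 2)) 0 / (n - N)"
      using \<open>N < n\<close> by simp
    finally show ?thesis .
  qed
  then show ?thesis
    using real \<open>N < n\<close> by (simp add: N_star_def)
qed (use assms in \<open>auto simp: N_star_def\<close>)

text \<open>With the quotient in place of its positive part both sides agree; the positive part
  replaces a negative quotient exactly when \<open>N < 2 < N'\<close>.\<close>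

lemma N_star_discriminant:
  assumes N: "1 \<le> N" and less: "ereal N < N'"
  shows "(2/N - 1)\<^sup>2 \<le> (1/N - real_of_ereal (1/N')) * (4/N + N_star N N' - 4)"
proof (cases N')
  case (real n)
  then have "N < n" using less by simp
  then have n: "n > 0" "n - N > 0" using N by auto
  define M where "M = (N - 2) * (n - 2) / (n - N)"
  have M: "M * (n - N) = (N - 2) * (n - 2)"
    using n by (simp add: M_def)
  have "max ((N - 2) * (n - 2)) 0 / (n - N) = max M 0"
    using n by (simp add: M_def max_def divide_le_0_iff zero_le_divide_iff)
  then have N_star: "N_star N N' = 2 + max M 0"
    using real by (simp add: N_star_def)
  have "N\<^sup>2 * n * (2/N - 1)\<^sup>2 = (2 - N)\<^sup>2 * n"
    using N by (simp add: field_simps power2_eq_square)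
  also have "\<dots> = (n - N) * (4 - 2 * N) + N * (M * (n - N))"
    unfolding M by (simp add: algebra_simps power2_eq_square)
  also have "\<dots> = N\<^sup>2 * n * ((1/N - 1/n) * (4/N + (2 + M) - 4))"
    using N n by (simp add: field_simps power2_eq_square)
  finally have "(2/N - 1)\<^sup>2 = (1/N - 1/n) * (4/N + (2 + M) - 4)"
    using N n by simp
  also have "\<dots> \<le> (1/N - 1/n) * (4/N + (2 + max M 0) - 4)"
    using N n by (intro mult_left_mono) (auto simp: field_simps)
  finally show ?thesis
    using real n unfolding N_star by (simp add: one_ereal_def)
next
  case PInf
  have "(2/N - 1)\<^sup>2 = 1/N * (4/N + N - 4)"
    using N by (simp add: field_simps power2_eq_square)
  also have "\<dots> \<le> 1/N * (4/N + N_star N N' - 4)"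
    using N PInf by (intro mult_left_mono) (auto simp: N_star_def)
  finally show ?thesis
    using PInf by simp
qed (use less in auto)

lemma binary_quadratic_form_nonneg:
  fixes p q r a b :: real
  assumes "0 < p" "q\<^sup>2 \<le> p * r"
  shows "0 \<le> p * a\<^sup>2 + 2 * q * a * b + r * b\<^sup>2"
proof -
  have "p * (p * a\<^sup>2 + 2 * q * a * b + r * b\<^sup>2) = (p * a + q * b)\<^sup>2 + (p * r - q\<^sup>2) * b\<^sup>2"
    by (simp add: algebra_simps power2_eq_square)
  also have "\<dots> \<ge> 0"
    using assms by simp
  finally show ?thesis
    using assms(1) by (simp add: zero_le_mult_iff)
qed

section \<open>Bakry--Emery condition after a time change\<close>

lemma (in diffusion_operator) bakry_emery_time_change:
  assumes f: "f \<in> A" and N: "1 \<le> N" and BE: "bakry_emery A L k (ereal N)"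
    and less: "ereal N < N'"
  shows "bakry_emery A (time_change f L)
    (\<lambda>x. (f x)\<^sup>2 * k x + 1/2 * L (\<lambda>y. (f y)\<^sup>2) x - N_star N N' * \<Gamma> f f x) N'"
  unfolding bakry_emery_def
proof (intro ballI allI)
  fix u x assume u: "u \<in> A"
  define s where "s = real_of_ereal (1/N')"
  define S where "S = N_star N N'"
  let ?a = "f x * L u x" and ?b = "\<Gamma> u f x"
  have s: "0 < 1/N - s"
    using N less by (cases N') (auto simp: s_def one_ereal_def frac_less2)
  have "0 \<le> (1/N - s) * ?a\<^sup>2 + 2 * (2/N - 1) * ?a * ?b + (4/N + S - 4) * ?b\<^sup>2"
    using N_star_discriminant[OF N less] s unfolding s_def S_def
    by (intro binary_quadratic_form_nonneg) auto
  also have "\<dots> = 1/N * (?a + 2 * ?b)\<^sup>2 - s * ?a\<^sup>2 - 2 * ?a * ?b + (S - 2) * ?b\<^sup>2 - 2 * ?b\<^sup>2"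
    by (simp add: algebra_simps power2_eq_square add_divide_distrib)
  finally have form:
    "0 \<le> 1/N * (?a + 2 * ?b)\<^sup>2 - s * ?a\<^sup>2 - 2 * ?a * ?b + (S - 2) * ?b\<^sup>2 - 2 * ?b\<^sup>2" .
  have "S \<ge> 2"
    using N_star_ge[OF less] by (simp add: S_def)
  then have CS: "(S - 2) * ?b\<^sup>2 \<le> (S - 2) * (\<Gamma> u u x * \<Gamma> f f x)"
    using carre_du_champ_Cauchy_Schwarz[OF u f] by (intro mult_left_mono) auto
  define v where "v = (\<lambda>y. u y * f y - u x * f y)"
  have v: "v \<in> A"
    unfolding v_def using u f by (rule vanishing_product_mem)
  have "\<Gamma> v v x = (f x)\<^sup>2 * \<Gamma> u u x"
    using carre_du_champ_vanishing_product[OF u f v, of "u x" x]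
      carre_du_champ_vanishing_product[OF u f u, of "u x" x] carre_du_champ_commute[of u v]
    by (simp add: v_def power2_eq_square)
  moreover have "L v x = ?a + 2 * ?b"
    using L_vanishing_product[OF u f] by (simp add: v_def)
  moreover have "k x * \<Gamma> v v x + 1/N * (L v x)\<^sup>2 \<le> Gamma2 L v v x"
    using bspec[OF BE[unfolded bakry_emery_def] v] N by (simp add: one_ereal_def)
  ultimately have improved: "k x * ((f x)\<^sup>2 * \<Gamma> u u x) + 1/N * (?a + 2 * ?b)\<^sup>2 \<le>
      (f x)\<^sup>2 * Gamma2 L u u x + 2 * f x * \<Gamma> f (\<Gamma> u u) x + 2 * \<Gamma> u u x * \<Gamma> f f x + 2 * ?b\<^sup>2"
    using Gamma2_vanishing_product[OF u f, of x] by (simp add: v_def)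
  let ?l = "(f x)\<^sup>2 * k x * \<Gamma> u u x + 1/2 * L (\<lambda>y. (f y)\<^sup>2) x * \<Gamma> u u x
      - S * (\<Gamma> u u x * \<Gamma> f f x) + s * ?a\<^sup>2"
  let ?r = "(f x)\<^sup>2 * Gamma2 L u u x + 1/2 * L (\<lambda>y. (f y)\<^sup>2) x * \<Gamma> u u x
      + 2 * f x * \<Gamma> f (\<Gamma> u u) x - 2 * f x * L u x * ?b"
  have "?l \<le> ?r"
    using improved form CS by (simp add: algebra_simps)
  then have "(f x)\<^sup>2 * ?l \<le> (f x)\<^sup>2 * ?r"
    by (intro mult_left_mono) auto
  also have "\<dots> = Gamma2 (time_change f L) u u x"
    by (simp add: Gamma2_time_change[OF u f])
  finally show "((f x)\<^sup>2 * k x + 1/2 * L (\<lambda>y. (f y)\<^sup>2) x - N_star N N' * \<Gamma> f f x)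
        * carre_du_champ (time_change f L) u u x
      + real_of_ereal (1/N') * (time_change f L u x)\<^sup>2 \<le> Gamma2 (time_change f L) u u x"
    unfolding carre_du_champ_time_change s_def[symmetric] S_def[symmetric]
    by (simp add: time_change_def algebra_simps power2_eq_square)
qed

theorem corollary8p10:
  fixes A :: "('x \<Rightarrow> real) set"
    and L :: "('x \<Rightarrow> real) \<Rightarrow> 'x \<Rightarrow> real"
    and f k :: "'x \<Rightarrow> real"
    and N :: real
  assumes "diffusion_operator A L"
    and "f \<in> A"
    and "1 \<le> N"
    and "bakry_emery A L k (ereal N)"
  shows "(\<forall>N' :: ereal. ereal N < N' \<longrightarrow>
            N_star N N' \<ge> max N 2 \<and>
            bakry_emery A (time_change f L)
              (\<lambda>x. (f x)\<^sup>2 * k x + 1/2 * L (\<lambda>y. (f y)\<^sup>2) x - N_star N N' * carre_du_champ L f f x) N') \<and>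
         bakry_emery A (time_change f L)
           (\<lambda>x. (f x)\<^sup>2 * k x + 1/2 * L (\<lambda>y. (f y)\<^sup>2) x - max N 2 * carre_du_champ L f f x) \<infinity>"
proof -
  interpret diffusion_operator A L by fact
  have BE: "bakry_emery A (time_change f L)
      (\<lambda>x. (f x)\<^sup>2 * k x + 1/2 * L (\<lambda>y. (f y)\<^sup>2) x - N_star N N' * carre_du_champ L f f x) N'"
    if "ereal N < N'" for N'
    using assms(2-4) that by (rule bakry_emery_time_change)
  have "N_star N \<infinity> = max N 2"
    by (simp add: N_star_def)
  then have "bakry_emery A (time_change f L)
      (\<lambda>x. (f x)\<^sup>2 * k x + 1/2 * L (\<lambda>y. (f y)\<^sup>2) x - max N 2 * carre_du_champ L f f x) \<infinity>"
    using BE[of \<infinity>] by simp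
  then show ?thesis
    using BE N_star_ge by blast
qed

end
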